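(* Let $t$ be a (nonempty) transaction of a quantitative database. The sum $W(t)$ of the utilities in $t$ of all patterns that appear in $t$, i.e. $W(t)=\sum_{\emptyset\neq\varphi\subseteq t}u(\varphi,t)$, satisfies $$W(t)=2^{|t|-1}\sum_{X\in t}\omega(X,t).$$
   Context: Items come from a finite totally ordered set $\mathcal{I}$. A quantitative transaction $t$ is a nonempty finite set of $|t|$ distinct items, where each item $X\in t$ carries a quantity $q(X,t)$ (a real number), and each item $X$ has a user-defined weight $p(X)>0$. The weight of $X$ in $t$ is $\omega(X,t)=q(X,t)\,p(X)$. A quantitative database is a multiset of quantitative transactions. A pattern is a nonempty set of items $\varphi\subseteq\mathcal{I}$; it appears in $t$ if $\varphi\subseteq t$. The utility of a pattern $\varphi$ in $t$ is $u(\varphi,t)=\sum_{X\in\varphi}\omega(X,t)$ if $\varphi\subseteq t$, and $0$ otherwise. *)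

theory Defs
  imports Complex_Main "HOL-Library.Multiset"
begin

text \<open>
  A quantitative transaction is a partial map from items to quantities: its domain is the
  set of items it contains. Using a partial map rather than a set together with a total function
  makes equality of transactions, and so multiplicity in a database, independent of any quantities
  of absent items.
\<close>

type_synonym 'i transaction = "'i \<rightharpoonup> real"

type_synonym 'i database = "'i transaction multiset"

abbreviation items :: "'i transaction \<Rightarrow> 'i set" where
  "items t \<equiv> dom t"

definition is_transaction :: "'i set \<Rightarrow> 'i transaction \<Rightarrow> bool" where
  "is_transaction I t \<longleftrightarrow> finite (items t) \<and> items t \<noteq> {} \<and> items t \<subseteq> I"

definition is_database :: "'i set \<Rightarrow> 'i database \<Rightarrow> bool" where
  "is_database I D \<longleftrightarrow> (\<forall>t \<in># D. is_transaction I t)"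

text \<open>Only meaningful for items of the transaction.\<close>

definition quantity :: "'i \<Rightarrow> 'i transaction \<Rightarrow> real" where
  "quantity X t = the (t X)"

definition weight :: "('i \<Rightarrow> real) \<Rightarrow> 'i \<Rightarrow> 'i transaction \<Rightarrow> real" where
  "weight p X t = quantity X t * p X"

definition is_pattern :: "'i set \<Rightarrow> 'i set \<Rightarrow> bool" where
  "is_pattern I \<phi> \<longleftrightarrow> \<phi> \<noteq> {} \<and> \<phi> \<subseteq> I"

definition appears_in :: "'i set \<Rightarrow> 'i transaction \<Rightarrow> bool" where
  "appears_in \<phi> t \<longleftrightarrow> \<phi> \<subseteq> items t"

definition utility :: "('i \<Rightarrow> real) \<Rightarrow> 'i set \<Rightarrow> 'i transaction \<Rightarrow> real" where
  "utility p \<phi> t = (if appears_in \<phi> t then \<Sum>X\<in>\<phi>. weight p X t else 0)"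

definition total_utility :: "'i set \<Rightarrow> ('i \<Rightarrow> real) \<Rightarrow> 'i transaction \<Rightarrow> real" where
  "total_utility I p t = (\<Sum>\<phi> | is_pattern I \<phi> \<and> appears_in \<phi> t. utility p \<phi> t)"

end

theory Submission
  imports Defs
begin

text \<open>
  Exchanging the two summations, each item \<open>X \<in> t\<close> contributes its weight once for every
  pattern in \<open>t\<close> containing it, and these patterns correspond to the subsets of \<open>t - {X}\<close>.
\<close>

lemma card_Pow_containing:
  assumes "finite A" and "x \<in> A"
  shows "card {B \<in> Pow A. x \<in> B} = 2 ^ (card A - 1)"
proof -
  have "{B \<in> Pow A. x \<in> B} = insert x ` Pow (A - {x})"
  proof
    show "{B \<in> Pow A. x \<in> B} \<subseteq> insert x ` Pow (A - {x})"
    proof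
      fix B assume "B \<in> {B \<in> Pow A. x \<in> B}"
      \<comment> \<open>The preimage of \<open>B\<close> is \<open>B\<close> with \<open>x\<close>
        removed.\<close>
      then have "B = insert x (B - {x})" and "B - {x} \<in> Pow (A - {x})" by auto
      then show "B \<in> insert x ` Pow (A - {x})" by (rule image_eqI)
    qed
  qed (use assms in auto)
  \<comment> \<open>No set in the domain contains \<open>x\<close>, so deleting \<open>x\<close>
    undoes the insertion.\<close>
  moreover have "inj_on (insert x) (Pow (A - {x}))"
    by (rule inj_onI) blast
  ultimately show ?thesis
    using assms by (simp add: card_image card_Pow)
qed

text \<open>Double counting of the pairs \<open>x\<close> \<in> \<open>B\<close>. For empty
  \<open>A\<close> the truncated exponent is 0 and both sides vanish.\<close>

lemma sum_Pow_sum: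
  fixes f :: "'a \<Rightarrow> 'b::comm_semiring_1"
  assumes "finite A"
  shows "(\<Sum>B\<in>Pow A. \<Sum>x\<in>B. f x) = 2 ^ (card A - 1) * (\<Sum>x\<in>A. f x)"
proof -
  \<comment> \<open>Letting \<open>x\<close> range over the fixed set \<open>A\<close>, with
    membership in \<open>B\<close> as a side condition, makes the two sums exchangeable.\<close>
  have "(\<Sum>B\<in>Pow A. \<Sum>x\<in>B. f x) = (\<Sum>B\<in>Pow A. \<Sum>x | x \<in> A \<and> x \<in> B. f x)"
    by (intro sum.cong) auto
  also have "\<dots> = (\<Sum>x\<in>A. \<Sum>B | B \<in> Pow A \<and> x \<in> B. f x)"
    using assms by (intro sum.swap_restrict) auto
  also have "\<dots> = (\<Sum>x\<in>A. 2 ^ (card A - 1) * f x)"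
    by (intro sum.cong refl) (simp only: sum_constant card_Pow_containing[OF assms] of_nat_power of_nat_numeral)
  finally show ?thesis
    by (simp add: sum_distrib_left)
qed

theorem theorem2:
  fixes I :: "'i::linorder set"
    and p :: "'i \<Rightarrow> real"
    and D :: "'i database"
    and t :: "'i transaction"
  assumes "finite I"
    and "\<And>X. X \<in> I \<Longrightarrow> p X > 0"
    and "is_database I D"
    and "t \<in># D"
  shows "total_utility I p t = 2 ^ (card (items t) - 1) * (\<Sum>X\<in>items t. weight p X t)"
proof -
  have fin: "finite (items t)" and sub: "items t \<subseteq> I"
    using assms(3,4) by (auto simp: is_database_def is_transaction_def)
  \<comment> \<open>Since \<open>items t\<close> lies in \<open>I\<close>, every nonempty subset of
    it is a pattern.\<close>
  have "{\<phi>. is_pattern I \<phi> \<and> appears_in \<phi> t} = Pow (items t) - {{}}"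
    using sub by (auto simp: is_pattern_def appears_in_def)
  then have "total_utility I p t = (\<Sum>\<phi>\<in>Pow (items t) - {{}}. \<Sum>X\<in>\<phi>. weight p X t)"
    unfolding total_utility_def by (auto intro!: sum.cong simp: utility_def appears_in_def)
  \<comment> \<open>The empty set may be added back: its inner sum is 0.\<close>
  also have "\<dots> = (\<Sum>\<phi>\<in>Pow (items t). \<Sum>X\<in>\<phi>. weight p X t)"
    using fin by (intro sum.mono_neutral_left) auto
  also have "\<dots> = 2 ^ (card (items t) - 1) * (\<Sum>X\<in>items t. weight p X t)"
    using fin by (rule sum_Pow_sum)
  finally show ?thesis .
qed

end
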